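(* Fix a time step $t\ge 0$. Let $\bar c_t\in\mathbb{R}_{>0}$ be a constant such that $$\bar c_t\ \ge\ \sum_{j=1}^{\tilde M}\sum_{h\in\mathcal{C}^{(j)}}p^{(h)}\bigl\|\mathbf{\Gamma}\bigl(\boldsymbol{\eta}_t^{(h)}-\tilde{\boldsymbol{\eta}}_t^{(j)}\bigr)\bigr\|_1 .$$ Then $$\tilde J^\star(x_t,\tilde{\mathbb{P}})+\bar c_t\ \ge\ J^\star(x_t,\mathbb{P})\qquad\text{for all }x_t\in\mathcal{X},$$ where $J^\star(x_t,\mathbb{P})=\min_{\mathbf{u}}\{J(x_t,\mathbf{u},\mathbb{P}):\mathbf{u}\in\mathcal{F}(x_t,\mathbb{P})\}$ is the optimal value of the original problem and $\tilde J^\star(x_t,\tilde{\mathbb{P}})=\min_{\mathbf{u}}\{J(x_t,\mathbf{u},\tilde{\mathbb{P}}):\mathbf{u}\in\tilde{\mathcal{F}}(x_t,\tilde{\mathbb{P}})\}$ is the optimal value of the reduced problem with tightened constraints.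
   Context: **System.** Consider the discrete-time linear system $x_{t+1}=Ax_t+Bu_t+\eta_t$ with $x_t\in\mathbb{R}^n$, $u_t\in\mathbb{R}^m$, $\eta_t\in\mathbb{R}^n$, and a prediction horizon $N\ge 1$. For stacked vectors $\mathbf{u}_t=(u_t,\dots,u_{t+N-1})\in\mathbb{R}^{mN}$, $\boldsymbol{\eta}_t=(\eta_t,\dots,\eta_{t+N-1})\in\mathbb{R}^{nN}$, the stacked state $\mathbf{x}_t=(x_{t+1},\dots,x_{t+N})\in\mathbb{R}^{nN}$ satisfies $\mathbf{x}_t=\mathbf{F}x_t+\mathbf{G}\mathbf{u}_t+\mathbf{\Gamma}\boldsymbol{\eta}_t$, where $\mathbf{F},\mathbf{G},\mathbf{\Gamma}$ are the matrices determined by the dynamics, i.e. by $x_{t+k}=A^kx_t+\sum_{i=0}^{k-1}A^{k-1-i}(Bu_{t+i}+\eta_{t+i})$, $k=1,\dots,N$. **Constraints.** $\mathcal{X}=\{x\in\mathbb{R}^n: H_xx\le h_x\}$ and $\mathcal{U}=\{u\in\mathbb{R}^m:H_uu\le h_u\}$ are convex polytopic sets; $\mathcal{X}_N\subseteq\mathbb{R}^{nN}$ and $\mathcal{U}_N\subseteq\mathbb{R}^{mN}$ are their $N$-fold products (given by the corresponding block-diagonal inequalities). $\varepsilon\in[0,1)$ is a risk-tolerance parameter. $\mathbf{1}_X$ equals $1$ if the statement $X$ is true and $0$ otherwise. $\ominus$ is the Minkowski (Pontryagin) difference: $\mathcal{A}\ominus\mathcal{B}=\{a: a+b\in \mathcal{A}\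 \forall b\in \mathcal{B}\}$. **Original scenarios.** The distribution $\mathbb{P}$ of the disturbance signal is discrete with $M$ scenarios: scenario $j$ is a time series $(\eta_t^{(j)})_{t\ge0}$, occurring with probability $p^{(j)}\in(0,1]$, $\sum_{j=1}^Mp^{(j)}=1$. $\boldsymbol{\eta}_t^{(j)}=(\eta_t^{(j)},\dots,\eta_{t+N-1}^{(j)})\in\mathbb{R}^{nN}$ is the stacked scenario, and $\mathbf{x}_t^{(j)}=\mathbf{F}x_t+\mathbf{G}\mathbf{u}_t+\mathbf{\Gamma}\boldsymbol{\eta}_t^{(j)}$ the corresponding trajectory. **Reduced scenarios.** The reduced distribution $\tilde{\mathbb{P}}$ has $\tilde M<M$ representative stacked scenarios $\tilde{\boldsymbol{\eta}}_t^{(1)},\dots,\tilde{\boldsymbol{\eta}}_t^{(\tilde M)}\in\mathbb{R}^{nN}$, with trajectories $\tilde{\mathbf{x}}_t^{(j)}=\mathbf{F}x_t+\mathbf{G}\mathbf{u}_t+\mathbf{\Gamma}\tilde{\boldsymbol{\eta}}_t^{(j)}$. The cluster $\mathcal{C}^{(j)}\subseteq\{1,\dots,M\}$ is the set of indices $h$ whose scenario $\boldsymbol{\eta}_t^{(h)}$ is assigned to $\tilde{\boldsymbol{\eta}}_t^{(j)}$ as its closest representative, $\mathcal{C}^{(j)}=\{h:\arg\min_{i\in\{1,\dots,\tilde M\}}\|\boldsymbol{\eta}_t^{(h)}-\tilde{\boldsymbol{\eta}}_t^{(i)}\|_l^l=j\}$, with $l\in\{1,2\}$ fixed (ties broken so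 that each $h$ belongs to exactly one cluster, i.e. the clusters partition $\{1,\dots,M\}$). The probability of representative $j$ is $\tilde p^{(j)}=\sum_{h\in\mathcal{C}^{(j)}}p^{(h)}$, and it is assumed that $\tilde p^{(j)}\in(0,1]$. **Costs.** $J(x_t,\mathbf{u}_t,\mathbb{P})=\sum_{j=1}^Mp^{(j)}(\|\mathbf{x}_t^{(j)}\|_1+\|\mathbf{u}_t\|_1)$ and $J(x_t,\mathbf{u}_t,\tilde{\mathbb{P}})=\sum_{j=1}^{\tilde M}\tilde p^{(j)}(\|\tilde{\mathbf{x}}_t^{(j)}\|_1+\|\mathbf{u}_t\|_1)$. **Feasible sets.** $$\mathcal{F}(x_t,\mathbb{P})=\Bigl\{\mathbf{u}_t\in\mathbb{R}^{mN}:\ \sum_{j=1}^{M}p^{(j)}\mathbf{1}_{\mathbf{x}_t^{(j)}\in\mathcal{X}_N}\ge1-\varepsilon,\ \mathbf{u}_t\in\mathcal{U}_N\Bigr\},$$ $$\tilde{\mathcal{F}}(x_t,\tilde{\mathbb{P}})=\Bigl\{\mathbf{u}_t\in\mathbb{R}^{mN}:\ \sum_{j=1}^{\tilde M}\tilde p^{(j)}\mathbf{1}_{\tilde{\mathbf{x}}_t^{(j)}\in\mathcal{X}_N\ominus\mathcal{E}_t^{(j)}}\ge1-\varepsilon,\ \mathbf{u}_t\in\mathcal{U}_N\Bigr\},$$ where, for each $j$, $\mathcal{E}_t^{(j)}\subseteq\mathbb{R}^{nN}$ is a given set with $\mathbf{\Gamma}(\boldsymbol{\eta}_t^{(h)}-\tilde{\boldsymbol{\eta}}_t^{(j)})\in\mathcal{E}_t^{(j)}$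 for all $h\in\mathcal{C}^{(j)}$. The minimum over an empty set is taken to be $+\infty$. *)

theory Defs
  imports
    "HOL-Analysis.Function_Topology"
    "HOL-Library.Extended_Real"
    "Jordan_Normal_Form.Matrix"
begin

section \<open>Norms, polyhedra and stacked vectors\<close>

definition vec_norm :: "nat \<Rightarrow> real vec \<Rightarrow> real" where
  "vec_norm l v = root l (\<Sum>i<dim_vec v. \<bar>v $ i\<bar> ^ l)"

definition hpolyhedron :: "nat \<Rightarrow> real mat \<Rightarrow> real vec \<Rightarrow> real vec set" where
  "hpolyhedron d H h = {x \<in> carrier_vec d. H *\<^sub>v x \<le> h}"

text \<open>
  A stacked vector in $\mathbb{R}^{dN}$ consists of \<open>N\<close> consecutive blocks of length \<open>d\<close>,
  numbered from 0: entry \<open>k * d + i\<close> is entry \<open>i\<close> of block \<open>k\<close>.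
\<close>

definition block :: "nat \<Rightarrow> nat \<Rightarrow> real vec \<Rightarrow> real vec" where
  "block d k v = vec d (\<lambda>i. v $ (k * d + i))"

definition stacked :: "nat \<Rightarrow> nat \<Rightarrow> (nat \<Rightarrow> real vec) \<Rightarrow> nat \<Rightarrow> real vec" where
  "stacked d N s t = vec (d * N) (\<lambda>r. s (t + r div d) $ (r mod d))"

definition power_set :: "nat \<Rightarrow> nat \<Rightarrow> real vec set \<Rightarrow> real vec set" where
  "power_set d N S = {v \<in> carrier_vec (d * N). \<forall>k<N. block d k v \<in> S}"

definition pontryagin_diff :: "nat \<Rightarrow> real vec set \<Rightarrow> real vec set \<Rightarrow> real vec set" where
  "pontryagin_diff d S E = {a \<in> carrier_vec d. \<forall>b\<in>E. a + b \<in> S}"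


section \<open>Prediction over the horizon\<close>

text \<open>
  Block \<open>k\<close> of the stacked state is $x_{t+k+1}$. The block of \<open>F_mat\<close> in block row \<open>k\<close> is
  $A^{k+1}$; the blocks of \<open>G_mat\<close> and \<open>Gamma_mat\<close> in block row \<open>k\<close> and block column \<open>i\<close> are
  $A^{k-i}B$ and $A^{k-i}$ if $i \le k$, and zero otherwise.
\<close>

definition F_mat :: "nat \<Rightarrow> nat \<Rightarrow> real mat \<Rightarrow> real mat" where
  "F_mat n N A = mat (n * N) n (\<lambda>(r, c). (A ^\<^sub>m (r div n + 1)) $$ (r mod n, c))"

definition G_mat :: "nat \<Rightarrow> nat \<Rightarrow> nat \<Rightarrow> real mat \<Rightarrow> real mat \<Rightarrow> real mat" where
  "G_mat n m N A B = mat (n * N) (m * N) (\<lambda>(r, c).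
     if c div m \<le> r div n
     then (A ^\<^sub>m (r div n - c div m) * B) $$ (r mod n, c mod m) else 0)"

definition Gamma_mat :: "nat \<Rightarrow> nat \<Rightarrow> real mat \<Rightarrow> real mat" where
  "Gamma_mat n N A = mat (n * N) (n * N) (\<lambda>(r, c).
     if c div n \<le> r div n
     then (A ^\<^sub>m (r div n - c div n)) $$ (r mod n, c mod n) else 0)"

definition trajectory ::
  "nat \<Rightarrow> nat \<Rightarrow> nat \<Rightarrow> real mat \<Rightarrow> real mat \<Rightarrow> real vec \<Rightarrow> real vec \<Rightarrow> real vec \<Rightarrow> real vec" where
  "trajectory n m N A B x u w =
     F_mat n N A *\<^sub>v x + G_mat n m N A B *\<^sub>v u + Gamma_mat n N A *\<^sub>v w"


section \<open>Scenario-based optimal control\<close>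

text \<open>
  A discrete distribution of stacked disturbances is given by the number \<open>K\<close> of its scenarios,
  their probabilities \<open>p j\<close> and the stacked scenarios \<open>w j\<close>, for \<open>j \<in> {1..K}\<close>.
\<close>

definition cost ::
  "nat \<Rightarrow> nat \<Rightarrow> nat \<Rightarrow> real mat \<Rightarrow> real mat \<Rightarrow> real vec \<Rightarrow> real vec
    \<Rightarrow> nat \<Rightarrow> (nat \<Rightarrow> real) \<Rightarrow> (nat \<Rightarrow> real vec) \<Rightarrow> real" where
  "cost n m N A B x u K p w =
     (\<Sum>j=1..K. p j * (vec_norm 1 (trajectory n m N A B x u (w j)) + vec_norm 1 u))"

text \<open>
  \<open>T j\<close> is the set in which the trajectory of scenario \<open>j\<close> is required to lie: the stacked state
  constraint set itself in the original problem, its tightening in the reduced one.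
\<close>

definition feasible ::
  "nat \<Rightarrow> nat \<Rightarrow> nat \<Rightarrow> real mat \<Rightarrow> real mat \<Rightarrow> real vec set \<Rightarrow> real \<Rightarrow> real vec
    \<Rightarrow> nat \<Rightarrow> (nat \<Rightarrow> real) \<Rightarrow> (nat \<Rightarrow> real vec) \<Rightarrow> (nat \<Rightarrow> real vec set) \<Rightarrow> real vec set" where
  "feasible n m N A B U \<epsilon> x K p w T =
     {u \<in> carrier_vec (m * N).
        (\<Sum>j=1..K. p j * of_bool (trajectory n m N A B x u (w j) \<in> T j)) \<ge> 1 - \<epsilon>
        \<and> u \<in> power_set m N U}"

text \<open>
  The infimum in the extended reals is \<open>\<infinity>\<close> on an empty feasible set. On a nonempty one it is a
  minimum, see \<open>opt_value_attained_original\<close> and \<open>opt_value_attained_tightened\<close> below.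
\<close>

definition opt_value :: "(real vec \<Rightarrow> real) \<Rightarrow> real vec set \<Rightarrow> ereal" where
  "opt_value J S = (INF u\<in>S. ereal (J u))"

text \<open>
  \<open>a h\<close> is the index of the representative to which scenario \<open>h\<close> is assigned: a closest one, with
  an arbitrary choice in case of ties.
\<close>

definition closest_assignment ::
  "nat \<Rightarrow> nat \<Rightarrow> nat \<Rightarrow> (nat \<Rightarrow> real vec) \<Rightarrow> (nat \<Rightarrow> real vec) \<Rightarrow> (nat \<Rightarrow> nat) \<Rightarrow> bool" where
  "closest_assignment l M M' w w' a \<longleftrightarrow>
     (\<forall>h\<in>{1..M}. is_arg_min (\<lambda>i. vec_norm l (w h - w' i) ^ l) (\<lambda>i. i \<in> {1..M'}) (a h))"

definition cluster :: "nat \<Rightarrow> (nat \<Rightarrow> nat) \<Rightarrow> nat \<Rightarrow> nat set" where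
  "cluster M a j = {h \<in> {1..M}. a h = j}"

definition cluster_prob :: "nat \<Rightarrow> (nat \<Rightarrow> nat) \<Rightarrow> (nat \<Rightarrow> real) \<Rightarrow> nat \<Rightarrow> real" where
  "cluster_prob M a p j = (\<Sum>h\<in>cluster M a j. p h)"


section \<open>Existence of minimisers\<close>

lemma vec_norm_1: "vec_norm 1 v = (\<Sum>i<dim_vec v. \<bar>v $ i\<bar>)"
  by (simp add: vec_norm_def)

lemma attains_min:
  fixes J :: "real vec \<Rightarrow> real"
  assumes S: "S \<subseteq> carrier_vec d" "S \<noteq> {}"
    and cl: "closed {f. vec d f \<in> S}"
    and cont: "continuous_on UNIV (\<lambda>f. J (vec d f))"
    and coercive: "\<And>u. u \<in> S \<Longrightarrow> vec_norm 1 u \<le> J u"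
  shows "\<exists>u\<in>S. \<forall>v\<in>S. J u \<le> J v"
proof -
  obtain u0 where u0: "u0 \<in> S" using S by auto
  let ?K = "\<lambda>i. if i < d then {- J u0 .. J u0} else {0::real}"
  have "compactin (product_topology (\<lambda>i. euclidean) (UNIV::nat set)) (PiE UNIV ?K)"
    by (subst compactin_PiE) auto
  then have cK: "compact (PiE UNIV ?K)"
    by (simp add: euclidean_product_topology)
  let ?C = "PiE UNIV ?K \<inter> {f. vec d f \<in> S}"
  have cC: "compact ?C" using cK cl by (rule compact_Int_closed)
  have inK: "\<exists>f\<in>?C. vec d f = v" if v: "v \<in> S" "J v \<le> J u0" for v
  proof
    let ?f = "\<lambda>i. if i < d then v $ i else 0"
    have dv: "dim_vec v = d" using v S by auto
    show eq: "vec d ?f = v" using dv by auto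
    have "\<bar>v $ i\<bar> \<le> J u0" if "i < d" for i
    proof -
      have "\<bar>v $ i\<bar> \<le> (\<Sum>i<d. \<bar>v $ i\<bar>)"
        using that by (intro member_le_sum) auto
      also have "\<dots> = vec_norm 1 v" unfolding vec_norm_1 dv ..
      also have "\<dots> \<le> J u0" using coercive[OF v(1)] v(2) by simp
      finally show ?thesis .
    qed
    then have "?f \<in> PiE UNIV ?K"
      by (auto simp: PiE_iff abs_le_iff minus_le_iff)
    with eq v(1) show "?f \<in> ?C" by simp
  qed
  have ne: "?C \<noteq> {}" using inK[OF u0] by auto
  obtain f where f: "f \<in> ?C" "\<And>g. g \<in> ?C \<Longrightarrow> J (vec d f) \<le> J (vec d g)"
    using continuous_attains_inf[OF cC ne continuous_on_subset[OF cont subset_UNIV]] by blast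
  have "J (vec d f) \<le> J v" if v: "v \<in> S" for v
  proof (cases "J v \<le> J u0")
    case True
    then obtain g where "g \<in> ?C" "vec d g = v" using inK[OF v True] by (elim bexE)
    with f(2)[of g] show ?thesis by simp
  next
    case False
    from inK[OF u0 order_refl] obtain g where "g \<in> ?C" "vec d g = u0" by (elim bexE)
    with f(2)[of g] have "J (vec d f) \<le> J u0" by simp
    with False show ?thesis by simp
  qed
  with f(1) show ?thesis by (intro bexI[of _ "vec d f"]) auto
qed

text \<open>\<open>g\<close> ranges over vectors depending continuously on a parameter \<open>f\<close>.\<close>

lemma closed_hpolyhedron:
  fixes g :: "(nat \<Rightarrow> real) \<Rightarrow> real vec"
  assumes H: "H \<in> carrier_mat r d" and h: "h \<in> carrier_vec r"
    and g: "\<And>f. g f \<in> carrier_vec d"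
    and cont: "\<And>i. i < d \<Longrightarrow> continuous_on UNIV (\<lambda>f. g f $ i)"
  shows "closed {f. g f \<in> hpolyhedron d H h}"
proof -
  have d: "dim_vec (g f) = d" for f using g[of f] by auto
  have row: "row H i \<bullet> g f = (\<Sum>c\<in>{0..<d}. H $$ (i, c) * g f $ c)" if "i < r" for i f
    unfolding scalar_prod_def d using that H by (intro sum.cong) auto
  have "{f. g f \<in> hpolyhedron d H h} =
      (\<Inter>i\<in>{..<r}. {f. (\<Sum>c\<in>{0..<d}. H $$ (i, c) * g f $ c) \<le> h $ i})"
    using H h g by (auto simp: hpolyhedron_def less_eq_vec_def row)
  also have "closed \<dots>"
    by (intro closed_INT ballI closed_Collect_le continuous_intros cont) auto
  finally show ?thesis .
qed

lemma closed_power_set: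
  fixes g :: "(nat \<Rightarrow> real) \<Rightarrow> real vec"
  assumes H: "H \<in> carrier_mat r d" and h: "h \<in> carrier_vec r"
    and g: "\<And>f. g f \<in> carrier_vec (d * N)"
    and cont: "\<And>i. i < d * N \<Longrightarrow> continuous_on UNIV (\<lambda>f. g f $ i)"
  shows "closed {f. g f \<in> power_set d N (hpolyhedron d H h)}"
proof -
  have idx: "k * d + i < d * N" if "k < N" "i < d" for k i
  proof -
    have "k * d + i < Suc k * d" using that by simp
    also have "\<dots> \<le> N * d" using that by (intro mult_le_mono1) simp
    finally show ?thesis by (simp add: mult.commute)
  qed
  have "{f. g f \<in> power_set d N (hpolyhedron d H h)} =
      (\<Inter>k\<in>{..<N}. {f. block d k (g f) \<in> hpolyhedron d H h})"
    using g by (auto simp: power_set_def)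
  also have "closed \<dots>"
    by (intro closed_INT ballI closed_hpolyhedron[OF H h])
      (auto simp: block_def intro!: cont idx)
  finally show ?thesis .
qed

lemma trajectory_carrier: "trajectory n m N A B x u w \<in> carrier_vec (n * N)"
  unfolding trajectory_def F_mat_def G_mat_def Gamma_mat_def
  by (intro add_carrier_vec mult_mat_vec_carrier[OF mat_carrier] carrier_vecI) auto

lemma continuous_trajectory:
  assumes "r < n * N"
  shows "continuous_on UNIV (\<lambda>f. trajectory n m N A B x (vec (m * N) f) w $ r)"
proof -
  have eq: "(\<lambda>f. trajectory n m N A B x (vec (m * N) f) w $ r) =
      (\<lambda>f. (F_mat n N A *\<^sub>v x) $ r
         + (\<Sum>c\<in>{0..<m * N}. G_mat n m N A B $$ (r, c) * f c) + (Gamma_mat n N A *\<^sub>v w) $ r)"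
    using assms
    by (auto simp: trajectory_def F_mat_def G_mat_def Gamma_mat_def scalar_prod_def fun_eq_iff
        intro!: sum.cong)
  show ?thesis
    unfolding eq by (intro continuous_intros continuous_on_product_coordinates)
qed

lemma opt_value_attained:
  assumes Hu: "Hu \<in> carrier_mat q m" and hu: "hu \<in> carrier_vec q"
    and p: "\<And>j. j \<in> {1..K} \<Longrightarrow> 0 \<le> p j" "(\<Sum>j=1..K. p j) = 1"
    and T: "\<And>j. j \<in> {1..K} \<Longrightarrow>
      closed {f. trajectory n m N A B x (vec (m * N) f) (w j) \<in> T j}"
    and ne: "feasible n m N A B (hpolyhedron m Hu hu) \<epsilon> x K p w T \<noteq> {}"
      (is "?S \<noteq> {}")
  shows "\<exists>u\<in>?S. opt_value (\<lambda>u. cost n m N A B x u K p w) ?S = ereal (cost n m N A B x u K p w)"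
proof -
  let ?J = "\<lambda>u. cost n m N A B x u K p w"
  let ?t = "\<lambda>f j. trajectory n m N A B x (vec (m * N) f) (w j)"
  have dim_t: "dim_vec (trajectory n m N A B x u (w j)) = n * N" for u j
    using trajectory_carrier by (rule carrier_vecD)
  have pos: "0 \<le> vec_norm 1 v" for v unfolding vec_norm_1 by (intro sum_nonneg) auto
  let ?Q = "{I. I \<subseteq> {1..K} \<and> 1 - \<epsilon> \<le> sum p I}"
  have finQ: "finite ?Q" by (rule finite_subset[of _ "Pow {1..K}"]) auto
  have ind: "(\<Sum>j=1..K. p j * of_bool (?t f j \<in> T j)) = sum p {j \<in> {1..K}. ?t f j \<in> T j}" for f
    unfolding sum.inter_filter[OF finite_atLeastAtMost] by (rule sum.cong) auto
  have chance: "(1 - \<epsilon> \<le> (\<Sum>j=1..K. p j * of_bool (?t f j \<in> T j))) \<longleftrightarrow>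
      (\<exists>I\<in>?Q. \<forall>j\<in>I. ?t f j \<in> T j)" for f
  proof
    assume "1 - \<epsilon> \<le> (\<Sum>j=1..K. p j * of_bool (?t f j \<in> T j))"
    then have "{j \<in> {1..K}. ?t f j \<in> T j} \<in> ?Q"
      unfolding ind by (intro CollectI conjI) auto
    then show "\<exists>I\<in>?Q. \<forall>j\<in>I. ?t f j \<in> T j" by (rule bexI[rotated]) simp
  next
    assume "\<exists>I\<in>?Q. \<forall>j\<in>I. ?t f j \<in> T j"
    then obtain I where I: "I \<subseteq> {1..K}" "1 - \<epsilon> \<le> sum p I" "\<forall>j\<in>I. ?t f j \<in> T j" by auto
    have "sum p I \<le> sum p {j \<in> {1..K}. ?t f j \<in> T j}"
      using I p by (intro sum_mono2) auto
    with I show "1 - \<epsilon> \<le> (\<Sum>j=1..K. p j * of_bool (?t f j \<in> T j))"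
      unfolding ind by linarith
  qed
  have "{f. vec (m * N) f \<in> ?S} =
      (\<Union>I\<in>?Q. \<Inter>j\<in>I. {f. ?t f j \<in> T j})
      \<inter> {f. vec (m * N) f \<in> power_set m N (hpolyhedron m Hu hu)}"
    unfolding feasible_def mem_Collect_eq chance by auto
  also have "closed \<dots>"
    using Hu hu
    by (intro closed_Int closed_UN finQ ballI closed_INT closed_power_set T)
      (auto intro!: continuous_on_product_coordinates)
  finally have cl: "closed {f. vec (m * N) f \<in> ?S}" .
  have cont: "continuous_on UNIV (\<lambda>f. ?J (vec (m * N) f))"
    unfolding cost_def vec_norm_1 dim_t dim_vec
    by (intro continuous_intros continuous_trajectory)
      (auto intro!: continuous_intros continuous_on_product_coordinates)
  have coercive: "vec_norm 1 u \<le> ?J u" for u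
  proof -
    have "vec_norm 1 u = (\<Sum>j=1..K. p j * vec_norm 1 u)"
      using p(2) by (simp flip: sum_distrib_right)
    also have "\<dots> \<le> ?J u"
      unfolding cost_def using p(1) pos by (intro sum_mono mult_left_mono) auto
    finally show ?thesis .
  qed
  have sub: "?S \<subseteq> carrier_vec (m * N)" by (auto simp: feasible_def)
  obtain u where u: "u \<in> ?S" "\<forall>v\<in>?S. ?J u \<le> ?J v"
    using attains_min[OF sub ne cl cont coercive] by blast
  then have "opt_value ?J ?S = ereal (?J u)"
    unfolding opt_value_def by (intro antisym INF_lower INF_greatest) auto
  with u(1) show ?thesis by blast
qed

lemma opt_value_attained_original:
  assumes "Hx \<in> carrier_mat r n" "hx \<in> carrier_vec r"
    and "Hu \<in> carrier_mat q m" "hu \<in> carrier_vec q"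
    and "\<And>j. j \<in> {1..K} \<Longrightarrow> 0 \<le> p j" "(\<Sum>j=1..K. p j) = 1"
    and "feasible n m N A B (hpolyhedron m Hu hu) \<epsilon> x K p w
      (\<lambda>j. power_set n N (hpolyhedron n Hx hx)) \<noteq> {}" (is "?S \<noteq> {}")
  shows "\<exists>u\<in>?S. opt_value (\<lambda>u. cost n m N A B x u K p w) ?S = ereal (cost n m N A B x u K p w)"
  using assms
  by (intro opt_value_attained closed_power_set trajectory_carrier continuous_trajectory)

lemma opt_value_attained_tightened:
  assumes Hx: "Hx \<in> carrier_mat r n" "hx \<in> carrier_vec r"
    and Hu: "Hu \<in> carrier_mat q m" "hu \<in> carrier_vec q"
    and p: "\<And>j. j \<in> {1..K} \<Longrightarrow> 0 \<le> p j" "(\<Sum>j=1..K. p j) = 1"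
    and E: "\<And>j. j \<in> {1..K} \<Longrightarrow> E j \<subseteq> carrier_vec (n * N)"
    and ne: "feasible n m N A B (hpolyhedron m Hu hu) \<epsilon> x K p w
      (\<lambda>j. pontryagin_diff (n * N) (power_set n N (hpolyhedron n Hx hx)) (E j)) \<noteq> {}"
      (is "?S \<noteq> {}")
  shows "\<exists>u\<in>?S. opt_value (\<lambda>u. cost n m N A B x u K p w) ?S = ereal (cost n m N A B x u K p w)"
proof (rule opt_value_attained[OF Hu p _ ne])
  fix j assume j: "j \<in> {1..K}"
  let ?t = "\<lambda>f. trajectory n m N A B x (vec (m * N) f) (w j)"
  have "{f. ?t f \<in> pontryagin_diff (n * N) (power_set n N (hpolyhedron n Hx hx)) (E j)} =
      (\<Inter>b\<in>E j. {f. ?t f + b \<in> power_set n N (hpolyhedron n Hx hx)})"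
    using trajectory_carrier by (auto simp: pontryagin_diff_def)
  also have "closed \<dots>"
  proof (intro closed_INT ballI closed_power_set[OF Hx])
    fix b assume "b \<in> E j"
    then have b: "b \<in> carrier_vec (n * N)" using E j by auto
    show "?t f + b \<in> carrier_vec (n * N)" for f
      using b trajectory_carrier by simp
    show "continuous_on UNIV (\<lambda>f. (?t f + b) $ i)" if "i < n * N" for i
    proof -
      have "(\<lambda>f. (?t f + b) $ i) = (\<lambda>f. ?t f $ i + b $ i)" using b that by auto
      then show ?thesis
        by (simp only:) (intro continuous_intros continuous_trajectory that)
    qed
  qed
  finally show "closed {f. ?t f \<in> pontryagin_diff (n * N) (power_set n N (hpolyhedron n Hx hx)) (E j)}" .
qed

end

theory Submission
  imports Defs
begin

text \<open>
  Every control that is feasible for the reduced problem is feasible for the original one: if the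
  trajectory of representative \<open>j\<close> satisfies the tightened constraint, then the trajectories of all
  scenarios in its cluster satisfy the original constraint, because they differ from it by elements
  of \<open>E j\<close>; and the cluster has the same probability as its representative. For a fixed control the
  triangle inequality bounds the difference of the two costs by \<open>c\<close>.
\<close>

lemma vec_norm_1_triangle:
  assumes "v \<in> carrier_vec d" "w \<in> carrier_vec d"
  shows "vec_norm 1 (v + w) \<le> vec_norm 1 v + vec_norm 1 w"
  using assms unfolding vec_norm_1
  by (auto simp: abs_triangle_ineq simp flip: sum.distrib intro!: sum_mono)

text \<open>The prediction is affine in the disturbance with linear part
  \<open>Gamma_mat n N A\<close>, so the state and control terms are common to both
  trajectories.\<close>

lemma trajectory_change_disturbance:
  assumes "v \<in> carrier_vec (n * N)" "w \<in> carrier_vec (n * N)"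
  shows "trajectory n m N A B x u v =
    trajectory n m N A B x u w + Gamma_mat n N A *\<^sub>v (v - w)"
proof -
  have G: "Gamma_mat n N A \<in> carrier_mat (n * N) (n * N)"
    by (simp add: Gamma_mat_def)
  \<comment> \<open>The split \<open>v = w + (v - w)\<close> is checked entrywise; it needs both
    vectors to have dimension \<open>n * N\<close>.\<close>
  have "Gamma_mat n N A *\<^sub>v v = Gamma_mat n N A *\<^sub>v (w + (v - w))"
    using assms by (intro arg_cong2[where f = mult_mat_vec] refl eq_vecI) auto
  also have "\<dots> = Gamma_mat n N A *\<^sub>v w + Gamma_mat n N A *\<^sub>v (v - w)"
    using assms by (intro mult_add_distrib_mat_vec[OF G]) auto
  finally have "Gamma_mat n N A *\<^sub>v v = Gamma_mat n N A *\<^sub>v w + Gamma_mat n N A *\<^sub>v (v - w)" .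
  moreover have "F_mat n N A *\<^sub>v x + G_mat n m N A B *\<^sub>v u \<in> carrier_vec (n * N)"
    unfolding F_mat_def G_mat_def
    by (intro add_carrier_vec mult_mat_vec_carrier[OF mat_carrier] carrier_vecI) auto
  ultimately show ?thesis
    unfolding trajectory_def using G assms
    by (simp add: assoc_add_vec[of _ "n * N"])
qed

lemma closest_assignment_range:
  "closest_assignment l M M' w w' a \<Longrightarrow> a ` {1..M} \<subseteq> {1..M'}"
  unfolding closest_assignment_def is_arg_min_def by blast

text \<open>The clusters are the fibres of \<open>a\<close>. As \<open>a\<close> maps into
  \<open>{1..M'}\<close>, they partition \<open>{1..M}\<close>, and on cluster \<open>j\<close> the
  index \<open>j\<close> may be replaced by \<open>a h\<close>.\<close>

lemma sum_over_clusters: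
  assumes "a ` {1..M} \<subseteq> {1..M'}"
  shows "(\<Sum>j=1..M'. \<Sum>h\<in>cluster M a j. f j h) = (\<Sum>h=1..M. f (a h) h)"
proof -
  have "(\<Sum>j=1..M'. \<Sum>h\<in>cluster M a j. f j h) = (\<Sum>j=1..M'. \<Sum>h\<in>cluster M a j. f (a h) h)"
    by (intro sum.cong) (auto simp: cluster_def)
  also have "\<dots> = (\<Sum>h=1..M. f (a h) h)"
    unfolding cluster_def using assms by (intro sum.group) auto
  finally show ?thesis .
qed

text \<open>An expectation under the reduced distribution is one under the original distribution in
  which each scenario is replaced by its representative. Chance constraint and cost can thus be
  compared scenario by scenario.\<close>

lemma sum_cluster_prob:
  assumes "a ` {1..M} \<subseteq> {1..M'}"
  shows "(\<Sum>j=1..M'. cluster_prob M a p j * g j) = (\<Sum>h=1..M. p h * g (a h))"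
  unfolding cluster_prob_def sum_distrib_right
  by (rule sum_over_clusters[OF assms])

lemma feasible_tightened_subset:
  assumes a: "a ` {1..M} \<subseteq> {1..M'}"
    and w: "\<And>h. h \<in> {1..M} \<Longrightarrow> w h \<in> carrier_vec (n * N)"
    and w': "\<And>j. j \<in> {1..M'} \<Longrightarrow> w' j \<in> carrier_vec (n * N)"
    and p: "\<And>h. h \<in> {1..M} \<Longrightarrow> 0 \<le> p h"
    and E: "\<And>h. h \<in> {1..M} \<Longrightarrow> Gamma_mat n N A *\<^sub>v (w h - w' (a h)) \<in> E (a h)"
  shows "feasible n m N A B U \<epsilon> x M' (cluster_prob M a p) w' (\<lambda>j. pontryagin_diff (n * N) S (E j))
    \<subseteq> feasible n m N A B U \<epsilon> x M p w (\<lambda>j. S)"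
proof
  let ?t = "trajectory n m N A B x"
  have w'a: "w' (a h) \<in> carrier_vec (n * N)" if "h \<in> {1..M}" for h
    using a that by (intro w') blast
  fix u
  assume u: "u \<in> feasible n m N A B U \<epsilon> x M' (cluster_prob M a p) w'
    (\<lambda>j. pontryagin_diff (n * N) S (E j))"
  \<comment> \<open>The two trajectories differ by an element of \<open>E (a h)\<close>, which the
    Pontryagin difference allows to be added without leaving \<open>S\<close>.\<close>
  have imp: "?t u (w h) \<in> S"
    if h: "h \<in> {1..M}" and t: "?t u (w' (a h)) \<in> pontryagin_diff (n * N) S (E (a h))" for h
    using t E[OF h] trajectory_change_disturbance[OF w[OF h] w'a[OF h]]
    by (auto simp: pontryagin_diff_def)
  have "1 - \<epsilon> \<le> (\<Sum>h=1..M. p h *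
      of_bool (?t u (w' (a h)) \<in> pontryagin_diff (n * N) S (E (a h))))"
    using u unfolding feasible_def mem_Collect_eq sum_cluster_prob[OF a] by (elim conjE)
  \<comment> \<open>By \<open>imp\<close> each indicator can only grow, and the weights are
    nonnegative.\<close>
  also have "\<dots> \<le> (\<Sum>h=1..M. p h * of_bool (?t u (w h) \<in> S))"
    using imp p by (intro sum_mono mult_left_mono) auto
  finally show "u \<in> feasible n m N A B U \<epsilon> x M p w (\<lambda>j. S)"
    using u by (simp add: feasible_def)
qed

lemma cost_le_reduced_cost:
  assumes a: "a ` {1..M} \<subseteq> {1..M'}"
    and w: "\<And>h. h \<in> {1..M} \<Longrightarrow> w h \<in> carrier_vec (n * N)"
    and w': "\<And>j. j \<in> {1..M'} \<Longrightarrow> w' j \<in> carrier_vec (n * N)"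
    and p: "\<And>h. h \<in> {1..M} \<Longrightarrow> 0 \<le> p h"
  shows "cost n m N A B x u M p w \<le> cost n m N A B x u M' (cluster_prob M a p) w'
    + (\<Sum>j=1..M'. \<Sum>h\<in>cluster M a j. p h * vec_norm 1 (Gamma_mat n N A *\<^sub>v (w h - w' j)))"
proof -
  let ?t = "trajectory n m N A B x u"
  have w'a: "w' (a h) \<in> carrier_vec (n * N)" if "h \<in> {1..M}" for h
    using a that by (intro w') blast
  let ?d = "\<lambda>h. Gamma_mat n N A *\<^sub>v (w h - w' (a h))"
  have "vec_norm 1 (?t (w h)) \<le> vec_norm 1 (?t (w' (a h))) + vec_norm 1 (?d h)"
    if h: "h \<in> {1..M}" for h
    unfolding trajectory_change_disturbance[OF w[OF h] w'a[OF h]]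
    by (intro vec_norm_1_triangle[OF trajectory_carrier] carrier_vecI) (simp add: Gamma_mat_def)
  then have "cost n m N A B x u M p w \<le>
      (\<Sum>h=1..M. p h * (vec_norm 1 (?t (w' (a h))) + vec_norm 1 (?d h) + vec_norm 1 u))"
    unfolding cost_def using p by (intro sum_mono mult_left_mono) auto
  also have "\<dots> = (\<Sum>h=1..M. p h * (vec_norm 1 (?t (w' (a h))) + vec_norm 1 u))
      + (\<Sum>h=1..M. p h * vec_norm 1 (?d h))"
    by (simp add: algebra_simps sum.distrib)
  \<comment> \<open>In the goal, the reduced cost and the double sum over clusters both become sums
    over \<open>{1..M}\<close>, matching the two sums just obtained.\<close>
  finally show ?thesis
    unfolding cost_def sum_cluster_prob[OF a] sum_over_clusters[OF a] .
qed

text \<open>Arguing with infima in \<open>ereal\<close> avoids choosing minimisers and covers an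
  empty \<open>S'\<close>, where the right-hand side is infinite.\<close>

lemma opt_value_le_add:
  assumes "S' \<subseteq> S" and "\<And>u. u \<in> S' \<Longrightarrow> J u \<le> J' u + c"
  shows "opt_value J S \<le> opt_value J' S' + ereal c"
proof -
  \<comment> \<open>With the finite constant on the left, the right-hand side is a bare infimum, so
    a lower bound for each \<open>u\<close> in \<open>S'\<close> suffices.\<close>
  have "opt_value J S - ereal c \<le> opt_value J' S'"
    unfolding opt_value_def
  proof (rule INF_greatest)
    fix u assume u: "u \<in> S'"
    have "(INF u\<in>S. ereal (J u)) \<le> ereal (J u)"
      using u assms(1) by (intro INF_lower) auto
    also have "\<dots> \<le> ereal (J' u) + ereal c"
      using assms(2)[OF u] by simp
    finally show "(INF u\<in>S. ereal (J u)) - ereal c \<le> ereal (J' u)"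
      by (simp add: ereal_minus_le_iff add.commute)
  qed
  then show ?thesis
    by (simp add: ereal_minus_le_iff add.commute)
qed

theorem theorem2:
  fixes n m N t M M' l rx ru :: nat
    and A B Hx Hu :: "real mat" and hx hu :: "real vec"
    and X U XN :: "real vec set"
    and \<epsilon> c :: real
    and \<eta> :: "nat \<Rightarrow> nat \<Rightarrow> real vec"
    and w w' :: "nat \<Rightarrow> real vec"
    and p p' :: "nat \<Rightarrow> real"
    and a :: "nat \<Rightarrow> nat" and C :: "nat \<Rightarrow> nat set"
    and E :: "nat \<Rightarrow> real vec set"
  assumes N: "N \<ge> 1"
    and A: "A \<in> carrier_mat n n" and B: "B \<in> carrier_mat n m"
    and Hx: "Hx \<in> carrier_mat rx n" "hx \<in> carrier_vec rx"
    and Hu: "Hu \<in> carrier_mat ru m" "hu \<in> carrier_vec ru"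
    and X: "X = hpolyhedron n Hx hx" and U: "U = hpolyhedron m Hu hu"
    and XN: "XN = power_set n N X"
    and eps: "0 \<le> \<epsilon>" "\<epsilon> < 1"
    and eta: "\<And>j s. j \<in> {1..M} \<Longrightarrow> \<eta> j s \<in> carrier_vec n"
    and w: "w = (\<lambda>j. stacked n N (\<eta> j) t)"
    and p: "\<And>j. j \<in> {1..M} \<Longrightarrow> 0 < p j \<and> p j \<le> 1" "(\<Sum>j=1..M. p j) = 1"
    and M': "M' < M"
    and w': "\<And>j. j \<in> {1..M'} \<Longrightarrow> w' j \<in> carrier_vec (n * N)"
    and l: "l \<in> {1, 2}"
    and assign: "closest_assignment l M M' w w' a"
    and C: "C = cluster M a"
    and p': "p' = cluster_prob M a p" "\<And>j. j \<in> {1..M'} \<Longrightarrow> 0 < p' j \<and> p' j \<le> 1"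
    and E: "\<And>j. j \<in> {1..M'} \<Longrightarrow> E j \<subseteq> carrier_vec (n * N)"
      "\<And>j h. j \<in> {1..M'} \<Longrightarrow> h \<in> C j \<Longrightarrow> Gamma_mat n N A *\<^sub>v (w h - w' j) \<in> E j"
    and c: "c > 0"
      "c \<ge> (\<Sum>j=1..M'. \<Sum>h\<in>C j. p h * vec_norm 1 (Gamma_mat n N A *\<^sub>v (w h - w' j)))"
  shows "\<forall>x\<in>X.
      opt_value (\<lambda>u. cost n m N A B x u M' p' w')
        (feasible n m N A B U \<epsilon> x M' p' w' (\<lambda>j. pontryagin_diff (n * N) XN (E j))) + ereal c
      \<ge> opt_value (\<lambda>u. cost n m N A B x u M p w)
        (feasible n m N A B U \<epsilon> x M p w (\<lambda>j. XN))"
proof (intro ballI opt_value_le_add)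
  fix x
  have a: "a ` {1..M} \<subseteq> {1..M'}"
    using assign by (rule closest_assignment_range)
  have wc: "w h \<in> carrier_vec (n * N)" for h
    by (simp add: w stacked_def)
  have p0: "0 \<le> p h" if "h \<in> {1..M}" for h
    using p(1)[OF that] by simp
  have "Gamma_mat n N A *\<^sub>v (w h - w' (a h)) \<in> E (a h)" if "h \<in> {1..M}" for h
  proof (rule E(2))
    show "a h \<in> {1..M'}" using a that by blast
    show "h \<in> C (a h)" using that by (simp add: C cluster_def)
  qed
  then show "feasible n m N A B U \<epsilon> x M' p' w' (\<lambda>j. pontryagin_diff (n * N) XN (E j))
      \<subseteq> feasible n m N A B U \<epsilon> x M p w (\<lambda>j. XN)"
    unfolding p'(1) using a wc w' p0 by (intro feasible_tightened_subset)
  \<comment> \<open>The cost bound is shown for an arbitrary \<open>u\<close>, feasible or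
    not.\<close>
  fix u
  have "cost n m N A B x u M p w \<le> cost n m N A B x u M' p' w'
      + (\<Sum>j=1..M'. \<Sum>h\<in>C j. p h * vec_norm 1 (Gamma_mat n N A *\<^sub>v (w h - w' j)))"
    unfolding p'(1) C using a wc w' p0 by (intro cost_le_reduced_cost)
  with c(2) show "cost n m N A B x u M p w \<le> cost n m N A B x u M' p' w' + c"
    by linarith
qed

end
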